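(* The algebra $\mathbf{PBT}$ is free (as an associative algebra) on the set $\{\mathbf{P}_T\}$, and also on the set $\{\mathbf{H}_T\}$, where $T$ runs over the nonempty binary trees whose root has no right child. Equivalently, $T$ runs over the nonempty trees whose canonical word $w_T$ is an anticonnected permutation.
   Context: For a word $w$, $\mathrm{std}(w)$ is obtained by scanning $w$ left to right and labelling $1,2,\dots$ the occurrences of its smallest letter, then the next smallest, etc. For $\sigma\in S_n$, $\mathbf{F}_\sigma=\sum_{\mathrm{std}(w)=\sigma^{-1}}w$ in $\mathbb{K}\langle A\rangle$ ($A=\{1<2<\cdots\}$, $\mathbb{K}$ of characteristic $0$); they span the algebra $\mathbf{FQSym}$. A binary tree is empty or a node with left and right subtrees. $\mathrm{bst}(w)$ is obtained by reading $w$ right to left and inserting each letter $x$: into an empty tree create a node labeled $x$; otherwise insert recursively into the left subtree if $x\le$ root label, into the right subtree if $x>$ root label. For an unlabeled tree $T$ with $n$ nodes, $w_T\in S_n$ is the right-to-left postfix reading (right subtree, left subtree, root, recursively) of the unique labeling of $T$ by $1,\dots,n$ with each label greater than those of its left subtree and smaller than those of its right subtree. $\mathbf{P}_T=\sum_{\mathrm{shape}(\mathrm{bst}(\sigma))=T}\mathbf{F}_\sigma$; $\mathbf{PBT}$ is the subalgebra of $\mathbf{FQSym}$ spanned by the $\mathbf{P}_T$. The weak order on $S_n$ is the reflexive transitive closure of $\sigma<\sigma s_i$ whenever exchanging the letters in positions $i,i+1$ of $\sigma$ increases the number of inversions; $\mathbf{H}_T=\sum_{T'}\mathbf{P}_{T'}$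 over trees $T'$ with $w_{T'}\le w_T$ in the weak order. For $u\in S_k$, $v\in S_l$, the shifted concatenation is $u\bullet v=u\cdot v[k]$, where $v[k]$ adds $k$ to each letter; a permutation is connected if it cannot be written as $u\bullet v$ with $u,v$ nonempty, and anticonnected if its mirror image (the word read from right to left) is connected. *)

theory Defs
  imports
    "HOL-Library.Tree"
    "HOL-Combinatorics.Multiset_Permutations"
begin

section \<open>Noncommutative series and free algebras\<close>

text \<open>
  Since the alphabet is infinite, the elements of FQSym are infinite sums of words; they are
  formal series in noncommuting letters, given by an arbitrary coefficient for each word.
\<close>

typedef ('a, 'b) ncseries = "UNIV :: ('a list \<Rightarrow> 'b) set"
  morphisms nc_coeff Abs_ncseries ..

setup_lifting type_definition_ncseries

lemma ncseries_eqI: "(\<And>w. nc_coeff f w = nc_coeff g w) \<Longrightarrow> f = g"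
  by transfer auto

instantiation ncseries :: (type, ring_1) ring_1
begin

lift_definition zero_ncseries :: "('a, 'b) ncseries" is "\<lambda>_. 0" .

lift_definition one_ncseries :: "('a, 'b) ncseries" is "\<lambda>w. if w = [] then 1 else 0" .

lift_definition plus_ncseries :: "('a, 'b) ncseries \<Rightarrow> ('a, 'b) ncseries \<Rightarrow> ('a, 'b) ncseries"
  is "\<lambda>f g w. f w + g w" .

lift_definition minus_ncseries :: "('a, 'b) ncseries \<Rightarrow> ('a, 'b) ncseries \<Rightarrow> ('a, 'b) ncseries"
  is "\<lambda>f g w. f w - g w" .

lift_definition uminus_ncseries :: "('a, 'b) ncseries \<Rightarrow> ('a, 'b) ncseries"
  is "\<lambda>f w. - f w" .

lift_definition times_ncseries :: "('a, 'b) ncseries \<Rightarrow> ('a, 'b) ncseries \<Rightarrow> ('a, 'b) ncseries"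
  is "\<lambda>f g w. \<Sum>i\<le>length w. f (take i w) * g (drop i w)" .

instance
proof
  fix a b c :: "('a, 'b) ncseries"
  show "a + b + c = a + (b + c)" by transfer (simp add: add.assoc)
  show "a + b = b + a" by transfer (simp add: add.commute)
  show "0 + a = a" by transfer simp
  show "- a + a = 0" by transfer simp
  show "a - b = a + - b" by transfer simp
  show "(a + b) * c = a * c + b * c" by transfer (simp add: distrib_right sum.distrib)
  show "a * (b + c) = a * b + a * c" by transfer (simp add: distrib_left sum.distrib)
  show "(0 :: ('a, 'b) ncseries) \<noteq> 1" by transfer (metis zero_neq_one)
  show "1 * a = a"
  proof (transfer, rule ext)
    fix a :: "'a list \<Rightarrow> 'b" and w
    have "(\<Sum>i\<le>length w. (if take i w = [] then 1 else 0) * a (drop i w))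
        = (\<Sum>i\<in>{0}. (if take i w = [] then 1 else 0) * a (drop i w))"
      by (rule sum.mono_neutral_right) auto
    then show "(\<Sum>i\<le>length w. (if take i w = [] then 1 else 0) * a (drop i w)) = a w"
      by simp
  qed
  show "a * 1 = a"
  proof (transfer, rule ext)
    fix a :: "'a list \<Rightarrow> 'b" and w
    have "(\<Sum>i\<le>length w. a (take i w) * (if drop i w = [] then 1 else 0))
        = (\<Sum>i\<in>{length w}. a (take i w) * (if drop i w = [] then 1 else 0))"
      by (rule sum.mono_neutral_right) auto
    then show "(\<Sum>i\<le>length w. a (take i w) * (if drop i w = [] then 1 else 0)) = a w"
      by simp
  qed
  show "a * b * c = a * (b * c)"
  proof (transfer, rule ext)
    fix a b c :: "'a list \<Rightarrow> 'b" and w :: "'a list"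
    let ?n = "length w"
    have "(\<Sum>i\<le>?n. (\<Sum>j\<le>length (take i w). a (take j (take i w)) * b (drop j (take i w)))
             * c (drop i w))
        = (\<Sum>i\<le>?n. \<Sum>j\<le>i. a (take j w) * b (drop j (take i w)) * c (drop i w))"
      by (auto simp: sum_distrib_right min_def intro!: sum.cong)
    also have "\<dots> = (\<Sum>(i, j)\<in>(SIGMA i:{..?n}. {..i}).
                      a (take j w) * b (drop j (take i w)) * c (drop i w))"
      by (rule sum.Sigma) auto
    also have "\<dots> = (\<Sum>(j, k)\<in>(SIGMA j:{..?n}. {..?n - j}).
                      a (take j w) * b (take k (drop j w)) * c (drop (j + k) w))"
      by (rule sum.reindex_bij_witness
            [where i = "\<lambda>(j, k). (j + k, j)" and j = "\<lambda>(i, j). (j, i - j)"])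
         (auto simp: drop_take)
    also have "\<dots> = (\<Sum>j\<le>?n. \<Sum>k\<le>?n - j.
                      a (take j w) * b (take k (drop j w)) * c (drop (j + k) w))"
      by (rule sum.Sigma [symmetric]) auto
    also have "\<dots> = (\<Sum>j\<le>?n. a (take j w) *
        (\<Sum>k\<le>length (drop j w). b (take k (drop j w)) * c (drop k (drop j w))))"
      by (auto simp: sum_distrib_left mult.assoc add.commute intro!: sum.cong)
    finally show "(\<Sum>i\<le>?n. (\<Sum>j\<le>length (take i w).
          a (take j (take i w)) * b (drop j (take i w))) * c (drop i w))
        = (\<Sum>j\<le>?n. a (take j w) *
            (\<Sum>k\<le>length (drop j w). b (take k (drop j w)) * c (drop k (drop j w))))" .
  qed
qed

end

lift_definition nc_scale :: "'k::ring_1 \<Rightarrow> ('a, 'k) ncseries \<Rightarrow> ('a, 'k) ncseries"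
  is "\<lambda>c f w. c * f w" .

global_interpretation ncseries: vector_space "nc_scale :: 'k::field \<Rightarrow> ('a, 'k) ncseries \<Rightarrow> _"
  by unfold_locales (transfer; simp add: algebra_simps)+

lift_definition nc_letter :: "'a \<Rightarrow> ('a, 'k::ring_1) ncseries"
  is "\<lambda>x w. if w = [x] then 1 else 0" .

text \<open>The free associative unital algebra on a set of letters: noncommutative polynomials.\<close>

definition free_algebra :: "'a set \<Rightarrow> ('a, 'k::ring_1) ncseries set" where
  "free_algebra X = {p. finite {w. nc_coeff p w \<noteq> 0} \<and> {w. nc_coeff p w \<noteq> 0} \<subseteq> lists X}"

text \<open>
  \<open>S\<close> is free on the family \<open>(b x)\<close>, \<open>x \<in> X\<close>: there is an isomorphism of unital algebras from the
  free algebra on \<open>X\<close> onto \<open>S\<close> that sends each letter \<open>x\<close> to \<open>b x\<close>.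
\<close>

definition free_on ::
  "('b, 'k::field) ncseries set \<Rightarrow> 'a set \<Rightarrow> ('a \<Rightarrow> ('b, 'k) ncseries) \<Rightarrow> bool" where
  "free_on S X b \<longleftrightarrow> (\<exists>\<phi> :: ('a, 'k) ncseries \<Rightarrow> ('b, 'k) ncseries.
     \<phi> 1 = 1 \<and>
     (\<forall>p\<in>free_algebra X. \<forall>q\<in>free_algebra X. \<phi> (p + q) = \<phi> p + \<phi> q) \<and>
     (\<forall>p\<in>free_algebra X. \<forall>q\<in>free_algebra X. \<phi> (p * q) = \<phi> p * \<phi> q) \<and>
     (\<forall>c. \<forall>p\<in>free_algebra X. \<phi> (nc_scale c p) = nc_scale c (\<phi> p)) \<and>
     (\<forall>x\<in>X. \<phi> (nc_letter x) = b x) \<and>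
     bij_betw \<phi> (free_algebra X) S)"

section \<open>Permutations as words\<close>

abbreviation perms :: "nat \<Rightarrow> nat list set" where
  "perms n \<equiv> permutations_of_set {1..n}"

definition perm_inverse :: "nat list \<Rightarrow> nat list" where
  "perm_inverse \<sigma> =
     map (\<lambda>k. Suc (THE i. i < length \<sigma> \<and> \<sigma> ! i = k)) [1..<Suc (length \<sigma>)]"

text \<open>
  The label of position \<open>i\<close> is the number of positions labelled up to and including \<open>i\<close>: those
  carrying a smaller letter, and those up to \<open>i\<close> carrying the same letter.
\<close>

definition std :: "nat list \<Rightarrow> nat list" where
  "std w = map (\<lambda>i. card {j. j < length w \<and> (w ! j < w ! i \<or> w ! j = w ! i \<and> j \<le> i)})
             [0..<length w]"

definition inversions :: "nat list \<Rightarrow> nat" where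
  "inversions \<sigma> = card {(i, j). i < j \<and> j < length \<sigma> \<and> \<sigma> ! i > \<sigma> ! j}"

definition weak_step :: "nat list \<Rightarrow> nat list \<Rightarrow> bool" where
  "weak_step \<sigma> \<tau> \<longleftrightarrow> (\<exists>i. Suc i < length \<sigma> \<and>
     \<tau> = \<sigma>[i := \<sigma> ! Suc i, Suc i := \<sigma> ! i] \<and> inversions \<sigma> < inversions \<tau>)"

definition weak_le :: "nat list \<Rightarrow> nat list \<Rightarrow> bool" where
  "weak_le = weak_step\<^sup>*\<^sup>*"

definition shifted_concat :: "nat list \<Rightarrow> nat list \<Rightarrow> nat list" where
  "shifted_concat u v = u @ map (\<lambda>x. x + length u) v"

definition connected_perm :: "nat list \<Rightarrow> bool" where
  "connected_perm \<sigma> \<longleftrightarrow> \<not> (\<exists>k l. \<exists>u\<in>perms k. \<exists>v\<in>perms l.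
     u \<noteq> [] \<and> v \<noteq> [] \<and> \<sigma> = shifted_concat u v)"

definition anticonnected_perm :: "nat list \<Rightarrow> bool" where
  "anticonnected_perm \<sigma> \<longleftrightarrow> connected_perm (rev \<sigma>)"

section \<open>Binary trees\<close>

type_synonym btree = "unit tree"

definition shape :: "'a tree \<Rightarrow> btree" where
  "shape = map_tree (\<lambda>_. ())"

fun bst_insert :: "nat \<Rightarrow> nat tree \<Rightarrow> nat tree" where
  "bst_insert x \<langle>\<rangle> = \<langle>\<langle>\<rangle>, x, \<langle>\<rangle>\<rangle>"
| "bst_insert x \<langle>l, a, r\<rangle> =
     (if x \<le> a then \<langle>bst_insert x l, a, r\<rangle> else \<langle>l, a, bst_insert x r\<rangle>)"

definition bst_of_word :: "nat list \<Rightarrow> nat tree" where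
  "bst_of_word w = foldr bst_insert w \<langle>\<rangle>"

fun rl_postfix :: "'a tree \<Rightarrow> 'a list" where
  "rl_postfix \<langle>\<rangle> = []"
| "rl_postfix \<langle>l, a, r\<rangle> = rl_postfix r @ rl_postfix l @ [a]"

definition canonical_labelling :: "btree \<Rightarrow> nat tree" where
  "canonical_labelling T = (THE t. shape t = T \<and> bst t \<and> set_tree t = {1..size T})"

definition canonical_word :: "btree \<Rightarrow> nat list" where
  "canonical_word T = rl_postfix (canonical_labelling T)"

section \<open>The algebra of planar binary trees\<close>

lift_definition bF :: "nat list \<Rightarrow> (nat, 'k::field_char_0) ncseries"
  is "\<lambda>\<sigma> w. if w \<in> lists {1..} \<and> std w = perm_inverse \<sigma> then 1 else 0" .

definition bP :: "btree \<Rightarrow> (nat, 'k::field_char_0) ncseries" where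
  "bP T = (\<Sum>\<sigma> \<in> {\<sigma> \<in> perms (size T). shape (bst_of_word \<sigma>) = T}. bF \<sigma>)"

definition bH :: "btree \<Rightarrow> (nat, 'k::field_char_0) ncseries" where
  "bH T = (\<Sum>T' \<in> {T'. weak_le (canonical_word T') (canonical_word T)}. bP T')"

definition PBT :: "(nat, 'k::field_char_0) ncseries set" where
  "PBT = ncseries.span (range bP)"

end

theory Submission
  imports Defs "HOL-Library.Product_Lexorder"
begin

text \<open>
  The shape of the binary search tree of a permutation is the shape of the decreasing tree of its
  inverse. Hence the coefficient of \<open>\<^bold>P\<^sub>T\<close> at a word \<open>w\<close> is \<open>1\<close> if \<open>T\<close> is the shape of the
  decreasing tree of \<open>w\<close> (root at the rightmost maximal letter), and \<open>0\<close> otherwise. Splitting a word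
  \<open>uv\<close> at its rightmost maximum, which lies either in \<open>u\<close> or in \<open>v\<close>, yields
  \<open>\<^bold>P\<^sub>T \<^bold>P\<^sub>T\<^sub>' = \<Sum> \<^bold>P\<^sub>X\<close> over a recursively described set of trees \<open>X\<close>.

  A tree is the same thing as the list of the trees \<open>T\<^sub>i = \<langle>L\<^sub>i, \<langle>\<rangle>\<rangle>\<close> along its right spine. By the product
  formula \<open>\<^bold>P\<^sub>T\<^sub>1 \<cdots> \<^bold>P\<^sub>T\<^sub>k\<close> is \<open>\<^bold>P\<close> of the tree with this spine plus terms with a shorter right spine, so
  these products form a basis. If \<open>T\<close> has no right child at the root, then \<open>w\<^sub>T\<close> ends with its maximum,
  and so do all words below it in the weak order. Hence \<open>\<^bold>H\<^sub>T\<close> equals \<open>\<^bold>P\<^sub>T\<close> plus some \<open>\<^bold>P\<^sub>T\<^sub>'\<close>, where \<open>T'\<close>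
  also has no right child at the root and \<open>w\<^sub>T\<^sub>'\<close> has fewer inversions, and triangularity persists with
  respect to the lexicographic order on (spine length, sum of the inversion numbers along the spine).
\<close>

section \<open>Decreasing trees\<close>

text \<open>Reversing the word makes the rightmost maximum the first one found. Ties go to the right
  because \<open>std\<close> gives the rightmost of several equal letters the largest label.\<close>

function dtree :: "nat list \<Rightarrow> btree" where
  "dtree w = (if w = [] then \<langle>\<rangle> else
     \<langle>dtree (rev (tl (dropWhile (\<lambda>x. x \<noteq> Max (set w)) (rev w)))), (),
      dtree (rev (takeWhile (\<lambda>x. x \<noteq> Max (set w)) (rev w)))\<rangle>)"
  by pat_completeness auto
termination
proof (relation "measure length")
  fix w :: "nat list"
  assume "w \<noteq> []"
  then show "(rev (tl (dropWhile (\<lambda>x. x \<noteq> Max (set w)) (rev w))), w) \<in> measure length"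
    using length_dropWhile_le[of "\<lambda>x. x \<noteq> Max (set w)" "rev w"]
    by (cases w) auto
  have "Max (set w) \<in> set (rev w)"
    using \<open>w \<noteq> []\<close> by simp
  then have "takeWhile (\<lambda>x. x \<noteq> Max (set w)) (rev w) \<noteq> rev w"
    by (metis (mono_tags) set_takeWhileD)
  then show "(rev (takeWhile (\<lambda>x. x \<noteq> Max (set w)) (rev w)), w) \<in> measure length"
    using length_takeWhile_le[of "\<lambda>x. x \<noteq> Max (set w)" "rev w"] takeWhile_eq_take
    by (metis in_measure le_neq_implies_less length_rev take_all_iff order_refl)
qed simp

declare dtree.simps [simp del]

lemma dtree_Nil [simp]: "dtree [] = \<langle>\<rangle>"
  by (simp add: dtree.simps)

text \<open>The two bounds characterize the rightmost maximum. This equation replaces the recursive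
  one, whose right-hand side is awkward to rewrite with.\<close>

lemma dtree_split:
  assumes "\<And>x. x \<in> set u \<Longrightarrow> x \<le> m" and "\<And>x. x \<in> set v \<Longrightarrow> x < m"
  shows "dtree (u @ m # v) = \<langle>dtree u, (), dtree v\<rangle>"
proof -
  have m: "Max (set (u @ m # v)) = m"
    using assms by (intro Max_eqI) (auto intro: less_imp_le)
  have v: "takeWhile (\<lambda>x. x \<noteq> m) (rev v @ m # rev u) = rev v"
    using assms(2) by (subst takeWhile_append2) auto
  have u: "dropWhile (\<lambda>x. x \<noteq> m) (rev v @ m # rev u) = m # rev u"
    using assms(2) by (subst dropWhile_append2) auto
  show ?thesis
    by (subst dtree.simps, unfold m) (simp add: u v)
qed

lemma rightmost_max_split:
  fixes w :: "'a::linorder list"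
  assumes "w \<noteq> []"
  obtains u m v where "w = u @ m # v"
    "\<And>x. x \<in> set u \<Longrightarrow> x \<le> m" "\<And>x. x \<in> set v \<Longrightarrow> x < m"
proof -
  have "Max (set w) \<in> set w"
    using assms by simp
  then obtain u v where w: "w = u @ Max (set w) # v" "Max (set w) \<notin> set v"
    by (metis split_list_last)
  have le: "x \<le> Max (set w)" if "x \<in> set w" for x
    using that by simp
  show thesis
  proof (rule that[OF w(1)])
    show "x \<le> Max (set w)" if "x \<in> set u" for x
      using that by (intro le, subst w(1)) simp
    show "x < Max (set w)" if "x \<in> set v" for x
    proof -
      have "x \<le> Max (set w)"
        using that by (intro le, subst w(1)) simp
      then show ?thesis
        using that w(2) by (auto simp: order_less_le)
    qed
  qed
qed

lemma dtree_eq_NodeE: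
  assumes "dtree w = \<langle>L, y, R\<rangle>"
  obtains u m v where "w = u @ m # v" "dtree u = L" "dtree v = R"
    "\<And>x. x \<in> set u \<Longrightarrow> x \<le> m" "\<And>x. x \<in> set v \<Longrightarrow> x < m"
proof -
  have "w \<noteq> []"
    using assms by auto
  then obtain u m v where w: "w = u @ m # v"
    "\<And>x. x \<in> set u \<Longrightarrow> x \<le> m" "\<And>x. x \<in> set v \<Longrightarrow> x < m"
    by (rule rightmost_max_split) blast
  show thesis
    using that[OF w(1)] w assms dtree_split[OF w(2,3)] by simp
qed

lemma size_dtree: "size (dtree w) = length w"
proof (induction w rule: length_induct)
  case (1 w)
  show ?case
  proof (cases "w = []")
    case False
    then obtain u m v where w: "w = u @ m # v"
      "\<And>x. x \<in> set u \<Longrightarrow> x \<le> m" "\<And>x. x \<in> set v \<Longrightarrow> x < m"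
      by (rule rightmost_max_split) blast
    show ?thesis
      using 1 by (simp add: w(1) dtree_split[OF w(2,3)])
  qed simp
qed

lemma dtree_eq_Leaf_iff [simp]: "dtree w = \<langle>\<rangle> \<longleftrightarrow> w = []"
  by (metis dtree_Nil size_dtree length_0_conv tree.size(3))

text \<open>Provides for every tree a word that detects it; the kernel argument for linear
  independence evaluates coefficients at such a word.\<close>

lemma ex_word_dtree: "\<exists>w\<in>lists {1..}. dtree w = T"
proof (induction T)
  case (Node L y R)
  then obtain u v where uv: "u \<in> lists {1..}" "dtree u = L" "v \<in> lists {1..}" "dtree v = R"
    by blast
  \<comment> \<open>Larger than every letter of \<open>u\<close> and \<open>v\<close>, since a
    letter is at most the sum of its word.\<close>
  let ?m = "Suc (sum_list u + sum_list v)"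
  have "dtree (u @ ?m # v) = \<langle>L, y, R\<rangle>"
    unfolding uv(2,4)[symmetric]
    by (subst dtree_split)
      (auto simp: less_Suc_eq_le intro: le_SucI trans_le_add1 trans_le_add2 member_le_sum_list)
  moreover have "u @ ?m # v \<in> lists {1..}"
    using uv by auto
  ultimately show ?case by blast
qed (auto intro!: bexI[of _ "[]"])

section \<open>Binary search trees versus decreasing trees\<close>

lemma bst_of_word_snoc:
  "bst_of_word (xs @ [a]) =
     \<langle>bst_of_word (filter (\<lambda>x. x \<le> a) xs), a, bst_of_word (filter (\<lambda>x. a < x) xs)\<rangle>"
  by (induction xs) (auto simp: bst_of_word_def)

text \<open>\<open>s\<close> lists positions by increasing key (letter, position), so its last entry
  \<open>p\<close>, the root of the search tree, is the position of the rightmost maximum, the root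
  of the decreasing tree. Both trees then separate the positions before \<open>p\<close> from those
  after \<open>p\<close>. An arbitrary interval is needed for the induction.\<close>

lemma shape_bst_of_word_sorted:
  fixes f :: "nat \<Rightarrow> nat"
  assumes "sorted_wrt (\<lambda>i j. (f i, i) < (f j, j)) s" and "set s = {a..<b}"
  shows "shape (bst_of_word s) = dtree (map f [a..<b])"
  using assms
proof (induction s arbitrary: a b rule: length_induct)
  case (1 s)
  show ?case
  proof (cases s rule: rev_cases)
    case Nil
    then show ?thesis
      using "1.prems"(2) by (auto simp: bst_of_word_def shape_def)
  next
    case (snoc t p)
    have st: "sorted_wrt (\<lambda>i j. (f i, i) < (f j, j)) t"
      and lt: "\<And>i. i \<in> set t \<Longrightarrow> (f i, i) < (f p, p)"
      using "1.prems"(1) by (auto simp: snoc sorted_wrt_append)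
    have p: "a \<le> p" "p < b" and t: "insert p (set t) = {a..<b}"
      using "1.prems"(2) by (auto simp: snoc)
    have pt: "p \<notin> set t"
      using lt by blast
    have t': "set t = {a..<b} - {p}"
      using t pt by blast
    have L: "shape (bst_of_word (filter (\<lambda>x. x \<le> p) t)) = dtree (map f [a..<p])"
    proof (rule "1.IH"[rule_format])
      show "length (filter (\<lambda>x. x \<le> p) t) < length s"
        by (simp add: snoc less_Suc_eq_le)
      show "set (filter (\<lambda>x. x \<le> p) t) = {a..<p}"
        using p by (auto simp: t')
    qed (rule sorted_wrt_filter[OF st])
    have R: "shape (bst_of_word (filter (\<lambda>x. p < x) t)) = dtree (map f [Suc p..<b])"
    proof (rule "1.IH"[rule_format])
      show "length (filter (\<lambda>x. p < x) t) < length s"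
        by (simp add: snoc less_Suc_eq_le)
      show "set (filter (\<lambda>x. p < x) t) = {Suc p..<b}"
        using p by (auto simp: t')
    qed (rule sorted_wrt_filter[OF st])
    have "[a..<b] = [a..<p] @ p # [Suc p..<b]"
      using p upt_add_eq_append[of a p "b - p"] by (simp add: upt_conv_Cons)
    \<comment> \<open>A smaller key means a weakly smaller letter for positions before
      \<open>p\<close> and a strictly smaller one for positions after \<open>p\<close>, exactly the
      bounds of \<open>dtree_split\<close>.\<close>
    moreover have "dtree (map f [a..<p] @ f p # map f [Suc p..<b]) =
        \<langle>dtree (map f [a..<p]), (), dtree (map f [Suc p..<b])\<rangle>"
    proof (rule dtree_split)
      show "x \<le> f p" if x: "x \<in> set (map f [a..<p])" for x
      proof -
        from x obtain i where i: "x = f i" "a \<le> i" "i < p"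
          by auto
        then show ?thesis
          using lt[of i] p by (auto simp: t')
      qed
      show "x < f p" if x: "x \<in> set (map f [Suc p..<b])" for x
      proof -
        from x obtain i where i: "x = f i" "p < i" "i < b"
          by auto
        then show ?thesis
          using lt[of i] p by (auto simp: t')
      qed
    qed
    ultimately show ?thesis
      using L R by (simp add: snoc bst_of_word_snoc shape_def)
  qed
qed

section \<open>Standardization as sorting of positions\<close>

lemma nth_perm_inverse:
  assumes "\<sigma> \<in> perms n" and "k < n"
  shows "perm_inverse \<sigma> ! (\<sigma> ! k - 1) = Suc k"
proof -
  have s: "distinct \<sigma>" "set \<sigma> = {1..n}" "length \<sigma> = n"
    using assms(1) by (auto simp: permutations_of_set_def dest: distinct_card)
  then have "\<sigma> ! k \<in> {1..n}"
    using assms(2) nth_mem by blast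
  moreover have "(THE i. i < n \<and> \<sigma> ! i = \<sigma> ! k) = k"
    using s assms(2) by (intro the_equality) (auto simp: nth_eq_iff_index_eq)
  ultimately show ?thesis
    unfolding perm_inverse_def using s by (subst nth_map) (auto simp del: upt_Suc)
qed

text \<open>The label of a position is the rank of its key (letter, position), so the inverse of the
  standardization lists the positions by increasing key. The shifts by one pass between positions
  from \<open>1\<close> and list indices from \<open>0\<close>.\<close>

lemma std_eq_perm_inverse_iff:
  assumes s: "\<sigma> \<in> perms n" and w: "length w = n"
  shows "std w = perm_inverse \<sigma> \<longleftrightarrow>
           sorted_wrt (\<lambda>i j. (w ! (i - 1), i) < (w ! (j - 1), j)) \<sigma>"
proof -
  define key where "key i = (w ! (i - 1), i)" for i
  have \<sigma>: "distinct \<sigma>" "set \<sigma> = {1..n}" "length \<sigma> = n"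
    using s by (auto simp: permutations_of_set_def dest: distinct_card)
  have bij: "bij_betw (\<lambda>k. \<sigma> ! k - 1) {..<n} {..<n}"
  proof -
    have "bij_betw ((!) \<sigma>) {..<n} {1..n}"
      using bij_betw_nth[OF \<sigma>(1), of "{..<n}"] \<sigma> by simp
    moreover have "bij_betw (\<lambda>i. i - 1) {1..n} {..<n}"
      by (rule bij_betwI[where g = Suc]) auto
    ultimately have "bij_betw ((\<lambda>i. i - 1) \<circ> (!) \<sigma>) {..<n} {..<n}"
      by (rule bij_betw_trans)
    then show ?thesis
      by (simp add: comp_def)
  qed
  have rank: "std w ! (\<sigma> ! k - 1) = card {l. l < n \<and> key (\<sigma> ! l) \<le> key (\<sigma> ! k)}"
    if k: "k < n" for k
  proof -
    have pos: "\<sigma> ! l \<ge> 1" if "l < n" for l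
      using that \<sigma> nth_mem by fastforce
    have "\<sigma> ! k - 1 < n"
      using bij k by (auto simp: bij_betw_def)
    then have "std w ! (\<sigma> ! k - 1) = card {j. j < n \<and> (w ! j < w ! (\<sigma> ! k - 1) \<or>
        w ! j = w ! (\<sigma> ! k - 1) \<and> j \<le> \<sigma> ! k - 1)}"
      by (simp add: std_def w)
    also have "{j. j < n \<and> (w ! j < w ! (\<sigma> ! k - 1) \<or>
        w ! j = w ! (\<sigma> ! k - 1) \<and> j \<le> \<sigma> ! k - 1)} =
        (\<lambda>l. \<sigma> ! l - 1) ` {l. l < n \<and> key (\<sigma> ! l) \<le> key (\<sigma> ! k)}" (is "?A = ?B")
    proof (intro set_eqI iffI)
      fix j assume j: "j \<in> ?A"
      then have "j \<in> (\<lambda>k. \<sigma> ! k - 1) ` {..<n}"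
        using bij by (simp add: bij_betw_def)
      then obtain l where "l < n" "j = \<sigma> ! l - 1"
        by auto
      then show "j \<in> ?B"
        using j pos[of l] pos[OF k] by (auto simp: key_def intro!: image_eqI[of _ _ l])
    next
      fix j assume "j \<in> ?B"
      then obtain l where l: "l < n" "j = \<sigma> ! l - 1" "key (\<sigma> ! l) \<le> key (\<sigma> ! k)"
        by auto
      moreover have "j < n"
        using bij l by (auto simp: bij_betw_def)
      ultimately show "j \<in> ?A"
        using pos[of l] pos[OF k] by (auto simp: key_def)
    qed
    also have "card \<dots> = card {l. l < n \<and> key (\<sigma> ! l) \<le> key (\<sigma> ! k)}"
      using bij by (intro card_image) (auto simp: bij_betw_def inj_on_def)
    finally show ?thesis .
  qed
  have "std w = perm_inverse \<sigma> \<longleftrightarrow> (\<forall>i\<in>{..<n}. std w ! i = perm_inverse \<sigma> ! i)"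
    using w \<sigma>(3) by (auto simp: list_eq_iff_nth_eq std_def perm_inverse_def)
  also have "\<dots> \<longleftrightarrow> (\<forall>k\<in>{..<n}. std w ! (\<sigma> ! k - 1) = Suc k)"
  proof -
    have "{..<n} = (\<lambda>k. \<sigma> ! k - 1) ` {..<n}"
      using bij by (simp add: bij_betw_def)
    then have "(\<forall>i\<in>{..<n}. std w ! i = perm_inverse \<sigma> ! i) \<longleftrightarrow>
        (\<forall>i\<in>(\<lambda>k. \<sigma> ! k - 1) ` {..<n}. std w ! i = perm_inverse \<sigma> ! i)"
      by (rule arg_cong)
    then show ?thesis
      using nth_perm_inverse[OF s] by simp
  qed
  also have "\<dots> \<longleftrightarrow> (\<forall>k<n. card {l. l < n \<and> key (\<sigma> ! l) \<le> key (\<sigma> ! k)} = Suc k)"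
    by (auto simp: rank simp del: One_nat_def)
  \<comment> \<open>If the keys failed to increase from \<open>i\<close> to \<open>j\<close>, the
    rank \<open>Suc j\<close> would be at most the rank \<open>Suc i\<close>.\<close>
  also have "\<dots> \<longleftrightarrow> (\<forall>i j. i < j \<longrightarrow> j < n \<longrightarrow> key (\<sigma> ! i) < key (\<sigma> ! j))" (is "?L \<longleftrightarrow> ?R")
  proof
    assume L: ?L
    show ?R
    proof (intro allI impI, rule ccontr)
      fix i j assume ij: "i < j" "j < n" "\<not> key (\<sigma> ! i) < key (\<sigma> ! j)"
      then have "key (\<sigma> ! j) \<le> key (\<sigma> ! i)"
        by (simp only: not_less)
      then have "card {l. l < n \<and> key (\<sigma> ! l) \<le> key (\<sigma> ! j)}
          \<le> card {l. l < n \<and> key (\<sigma> ! l) \<le> key (\<sigma> ! i)}"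
        by (intro card_mono) (auto intro: order_trans)
      then have "Suc j \<le> Suc i"
        using L ij by simp
      then show False
        using ij by simp
    qed
  next
    assume R: ?R
    show ?L
    proof (intro allI impI)
      fix k assume k: "k < n"
      have "key (\<sigma> ! l) \<le> key (\<sigma> ! k) \<longleftrightarrow> l \<le> k" if "l < n" for l
        using R that k by (metis leD leI le_neq_implies_less less_imp_le order_refl)
      then have "{l. l < n \<and> key (\<sigma> ! l) \<le> key (\<sigma> ! k)} = {..k}"
        using k by auto
      then show "card {l. l < n \<and> key (\<sigma> ! l) \<le> key (\<sigma> ! k)} = Suc k"
        by simp
    qed
  qed
  also have "\<dots> \<longleftrightarrow> sorted_wrt (\<lambda>i j. (w ! (i - 1), i) < (w ! (j - 1), j)) \<sigma>"
    by (simp only: sorted_wrt_iff_nth_less \<sigma>(3) key_def) 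
  finally show ?thesis .
qed

text \<open>Keys are pairwise distinct because they contain the position, so exactly one list
  enumerates them in increasing order.\<close>

lemma ex1_perm_std:
  assumes "length w = n"
  shows "\<exists>!\<sigma>. \<sigma> \<in> perms n \<and> std w = perm_inverse \<sigma>"
proof -
  define key where "key i = (w ! (i - 1), i)" for i
  have iff: "\<sigma> \<in> perms n \<and> std w = perm_inverse \<sigma> \<longleftrightarrow>
      map key \<sigma> = sorted_list_of_set (key ` {1..n})" for \<sigma>
  proof -
    have k: "snd (key i) = i" for i
      by (simp add: key_def)
    then have inj: "inj key"
      by (metis injI)
    have "map key \<sigma> = sorted_list_of_set (key ` {1..n}) \<longleftrightarrow>
        sorted_wrt (<) (map key \<sigma>) \<and> set (map key \<sigma>) = key ` {1..n}"
      by (metis finite_atLeastAtMost finite_imageI set_sorted_list_of_set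
          strict_sorted_list_of_set strict_sorted_equal)
    also have "\<dots> \<longleftrightarrow> sorted_wrt (<) (map key \<sigma>) \<and> \<sigma> \<in> perms n"
    proof -
      have "set (map key \<sigma>) = key ` {1..n} \<longleftrightarrow> set \<sigma> = {1..n}"
        using inj by (simp add: inj_image_eq_iff)
      moreover have "distinct \<sigma>" if "sorted_wrt (<) (map key \<sigma>)"
        using that by (metis distinct_map strict_sorted_iff)
      ultimately show ?thesis
        by (auto simp: permutations_of_set_def)
    qed
    also have "\<dots> \<longleftrightarrow> \<sigma> \<in> perms n \<and> std w = perm_inverse \<sigma>"
      using std_eq_perm_inverse_iff[OF _ assms] unfolding sorted_wrt_map key_def by blast
    finally show ?thesis ..
  qed
  have "map key (map snd (sorted_list_of_set (key ` {1..n}))) = sorted_list_of_set (key ` {1..n})"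
    unfolding map_map by (rule map_idI) (auto simp: key_def)
  moreover have "\<sigma> = \<tau>" if "map key \<sigma> = map key \<tau>" for \<sigma> \<tau>
    using arg_cong[OF that, of "map snd"] by (simp add: key_def comp_def)
  ultimately show ?thesis
    unfolding iff by metis
qed

lemma nc_coeff_sum: "nc_coeff (sum f A) w = (\<Sum>x\<in>A. nc_coeff (f x) w)"
  by (induction A rule: infinite_finite_induct)
    (auto simp: zero_ncseries.rep_eq plus_ncseries.rep_eq)

text \<open>Exactly one permutation \<open>\<tau>\<close> has \<open>std w\<close> as its inverse,
  so at most one summand is nonzero at \<open>w\<close>. The search tree of \<open>\<tau>\<close>
  has the shape of the decreasing tree of \<open>w\<close>.\<close>

theorem nc_coeff_bP:
  "nc_coeff (bP T :: (nat, 'k::field_char_0) ncseries) w =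
     (if w \<in> lists {1..} \<and> dtree w = T then 1 else 0)"
proof -
  obtain \<tau> where \<tau>: "\<tau> \<in> perms (length w)" "std w = perm_inverse \<tau>"
    and uniq: "\<And>\<sigma>. \<sigma> \<in> perms (length w) \<Longrightarrow> std w = perm_inverse \<sigma> \<Longrightarrow> \<sigma> = \<tau>"
    using ex1_perm_std[OF refl, of w] by (elim ex1E conjE) blast
  have "shape (bst_of_word \<tau>) = dtree (map (\<lambda>i. w ! (i - 1)) [1..<Suc (length w)])"
  proof (rule shape_bst_of_word_sorted)
    show "sorted_wrt (\<lambda>i j. (w ! (i - 1), i) < (w ! (j - 1), j)) \<tau>"
      by (rule iffD1[OF std_eq_perm_inverse_iff[OF \<tau>(1) refl] \<tau>(2)])
    have "set \<tau> = {1..length w}"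
      using \<tau>(1) by (rule permutations_of_setD)
    then show "set \<tau> = {1..<Suc (length w)}"
      by (simp only: atLeastLessThanSuc_atLeastAtMost)
  qed
  also have "map (\<lambda>i. w ! (i - 1)) [1..<Suc (length w)] = w"
    by (rule nth_equalityI) (auto simp del: upt_Suc)
  finally have shape: "shape (bst_of_word \<tau>) = dtree w" .
  let ?A = "{\<sigma> \<in> perms (size T). shape (bst_of_word \<sigma>) = T}"
  have eq: "\<sigma> \<in> ?A \<and> std w = perm_inverse \<sigma> \<longleftrightarrow> \<sigma> = \<tau> \<and> dtree w = T" for \<sigma>
  proof
    assume *: "\<sigma> \<in> ?A \<and> std w = perm_inverse \<sigma>"
    then have "length (std w) = length (perm_inverse \<sigma>)"
      by simp
    then have "length w = length \<sigma>"
      by (simp add: std_def perm_inverse_def del: upt_Suc)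
    moreover have "length \<sigma> = size T"
      using * by (auto simp: permutations_of_set_def dest: distinct_card)
    ultimately show "\<sigma> = \<tau> \<and> dtree w = T"
      using * uniq shape by auto
  next
    assume "\<sigma> = \<tau> \<and> dtree w = T"
    then show "\<sigma> \<in> ?A \<and> std w = perm_inverse \<sigma>"
      using \<tau> shape size_dtree[of w] by auto
  qed
  have "nc_coeff (bP T :: (nat, 'k) ncseries) w =
      (\<Sum>\<sigma>\<in>?A. if w \<in> lists {1..} \<and> std w = perm_inverse \<sigma> then 1 else 0)"
    by (simp add: bP_def nc_coeff_sum bF.rep_eq)
  also have "\<dots> = (\<Sum>\<sigma>\<in>?A. if \<sigma> = \<tau> then if w \<in> lists {1..} \<and> dtree w = T then 1 else 0 else 0)"
  proof (rule sum.cong)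
    fix \<sigma> assume "\<sigma> \<in> ?A"
    then show "(if w \<in> lists {1..} \<and> std w = perm_inverse \<sigma> then 1 else 0) =
        (if \<sigma> = \<tau> then if w \<in> lists {1..} \<and> dtree w = T then 1 else 0 else (0 :: 'k))"
      using eq[of \<sigma>] by (cases "w \<in> lists {1..}") simp_all
  qed simp
  also have "\<dots> = (if w \<in> lists {1..} \<and> dtree w = T then 1 else 0)"
    using eq[of \<tau>] \<tau>(2) by (subst sum.delta) auto
  finally show ?thesis .
qed

section \<open>The product of trees\<close>

text \<open>The recursion of the Loday-Ronco product: the root of a tree in the product comes either
  from the root of the first factor or from that of the second.\<close>

fun tprod :: "btree \<Rightarrow> btree \<Rightarrow> btree set" where
  "tprod \<langle>\<rangle> T = {T}"
| "tprod \<langle>L, x, R\<rangle> \<langle>\<rangle> = {\<langle>L, x, R\<rangle>}"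
| "tprod \<langle>L, x, R\<rangle> \<langle>L', y, R'\<rangle> =
     (\<lambda>X. \<langle>L, (), X\<rangle>) ` tprod R \<langle>L', y, R'\<rangle> \<union> (\<lambda>X. \<langle>X, (), R'\<rangle>) ` tprod \<langle>L, x, R\<rangle> L'"

lemma finite_tprod: "finite (tprod T T')"
  by (induction T T' rule: tprod.induct) auto

lemma dtree_append_in_tprod: "dtree (u @ v) \<in> tprod (dtree u) (dtree v)"
proof (induction "length u + length v" arbitrary: u v rule: less_induct)
  case less
  show ?case
  proof (cases "u = [] \<or> v = []")
    case True
    then show ?thesis
      by (cases "dtree u") auto
  next
    case False
    then obtain u1 m u2 where u: "u = u1 @ m # u2"
      "\<And>x. x \<in> set u1 \<Longrightarrow> x \<le> m" "\<And>x. x \<in> set u2 \<Longrightarrow> x < m"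
      by (metis rightmost_max_split)
    obtain v1 n v2 where v: "v = v1 @ n # v2"
      "\<And>x. x \<in> set v1 \<Longrightarrow> x \<le> n" "\<And>x. x \<in> set v2 \<Longrightarrow> x < n"
      using False by (metis rightmost_max_split)
    have du: "dtree u = \<langle>dtree u1, (), dtree u2\<rangle>" and dv: "dtree v = \<langle>dtree v1, (), dtree v2\<rangle>"
      using u v by (simp_all add: dtree_split)
    show ?thesis
    proof (cases "n < m")
      case True
      have "dtree (u1 @ m # (u2 @ v)) = \<langle>dtree u1, (), dtree (u2 @ v)\<rangle>"
        using u v True by (intro dtree_split) fastforce+
      moreover have "dtree (u2 @ v) \<in> tprod (dtree u2) (dtree v)"
        using less by (simp add: u(1))
      ultimately show ?thesis
        unfolding du dv by (simp add: u(1))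
    next
      \<comment> \<open>In a tie \<open>n = m\<close> the rightmost maximum lies in
        \<open>v\<close>, so ties belong to this case.\<close>
      case False
      have "dtree ((u @ v1) @ n # v2) = \<langle>dtree (u @ v1), (), dtree v2\<rangle>"
        using u v False by (intro dtree_split) fastforce+
      moreover have "dtree (u @ v1) \<in> tprod (dtree u) (dtree v1)"
        using less by (simp add: v(1))
      ultimately show ?thesis
        unfolding du dv by (simp add: v(1))
    qed
  qed
qed

text \<open>The branch of \<open>tprod\<close> that contains the tree tells on which side of the cut
  the rightmost maximum lies; the induction hypothesis then finds the cut in the part after it or in
  the part before it.\<close>

lemma dtree_in_tprodD:
  "dtree w \<in> tprod T T' \<Longrightarrow> \<exists>u v. w = u @ v \<and> dtree u = T \<and> dtree v = T'"
proof (induction T T' arbitrary: w rule: tprod.induct)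
  case (1 T)
  then show ?case
    by (intro exI[of _ "[]"] exI[of _ w]) auto
next
  case (2 L x R)
  then show ?case
    by (intro exI[of _ w] exI[of _ "[]"]) auto
next
  case (3 L x R L' y R')
  then consider X where "dtree w = \<langle>L, (), X\<rangle>" "X \<in> tprod R \<langle>L', y, R'\<rangle>"
    | X where "dtree w = \<langle>X, (), R'\<rangle>" "X \<in> tprod \<langle>L, x, R\<rangle> L'"
    by auto
  then show ?case
  proof cases
    case 1
    from 1(1) obtain a m b where w: "w = a @ m # b" "dtree a = L" "dtree b = X"
      "\<And>x. x \<in> set a \<Longrightarrow> x \<le> m" "\<And>x. x \<in> set b \<Longrightarrow> x < m"
      by (rule dtree_eq_NodeE) blast
    obtain u v where uv: "b = u @ v" "dtree u = R" "dtree v = \<langle>L', y, R'\<rangle>"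
      using "3.IH"(1)[of b] 1 w by auto
    have "dtree (a @ m # u) = \<langle>L, x, R\<rangle>"
      using dtree_split[of a m u] w uv by simp
    then show ?thesis
      using w uv by (intro exI[of _ "a @ m # u"] exI[of _ v]) simp
  next
    case 2
    from 2(1) obtain a m b where w: "w = a @ m # b" "dtree a = X" "dtree b = R'"
      "\<And>x. x \<in> set a \<Longrightarrow> x \<le> m" "\<And>x. x \<in> set b \<Longrightarrow> x < m"
      by (rule dtree_eq_NodeE) blast
    obtain u v where uv: "a = u @ v" "dtree u = \<langle>L, x, R\<rangle>" "dtree v = L'"
      using "3.IH"(2)[of a] 2 w by auto
    have "dtree (v @ m # b) = \<langle>L', y, R'\<rangle>"
      using dtree_split[of v m b] w uv by simp
    then show ?thesis
      using w uv by (intro exI[of _ u] exI[of _ "v @ m # b"]) simp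
  qed
qed

lemma dtree_in_tprod_iff:
  "dtree w \<in> tprod T T' \<longleftrightarrow>
     size T \<le> length w \<and> dtree (take (size T) w) = T \<and> dtree (drop (size T) w) = T'"
proof
  assume "dtree w \<in> tprod T T'"
  then show "size T \<le> length w \<and> dtree (take (size T) w) = T \<and> dtree (drop (size T) w) = T'"
    using dtree_in_tprodD[of w T T'] by (auto simp: size_dtree)
next
  assume "size T \<le> length w \<and> dtree (take (size T) w) = T \<and> dtree (drop (size T) w) = T'"
  then show "dtree w \<in> tprod T T'"
    using dtree_append_in_tprod[of "take (size T) w" "drop (size T) w"] by simp
qed

theorem bP_mult: "bP T * bP T' = (\<Sum>X\<in>tprod T T'. bP X :: (nat, 'k::field_char_0) ncseries)"
proof (rule ncseries_eqI)
  fix w :: "nat list"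
  let ?A = "lists {1..} :: nat list set"
  let ?c = "\<lambda>i. if w \<in> ?A \<and> dtree (take i w) = T \<and> dtree (drop i w) = T' then 1 else 0 :: 'k"
  have A: "w \<in> ?A \<longleftrightarrow> take i w \<in> ?A \<and> drop i w \<in> ?A" for i
    by (metis append_in_lists_conv append_take_drop_id)
  have "nc_coeff (bP T * bP T' :: (nat, 'k) ncseries) w = (\<Sum>i\<le>length w. ?c i)"
    unfolding times_ncseries.rep_eq nc_coeff_bP
    by (intro sum.cong refl) (use A in auto)
  \<comment> \<open>A prefix whose tree is \<open>T\<close> has \<open>size T\<close> letters, so
    one cut survives and the product is multiplicity free.\<close>
  also have "\<dots> = (\<Sum>i\<le>length w. if i = size T then ?c i else 0)"
    by (intro sum.cong refl) (auto simp: size_dtree)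
  also have "\<dots> = (if w \<in> ?A \<and> dtree w \<in> tprod T T' then 1 else 0)"
    by (auto simp: dtree_in_tprod_iff)
  also have "\<dots> = nc_coeff (\<Sum>X\<in>tprod T T'. bP X :: (nat, 'k) ncseries) w"
  proof (cases "w \<in> ?A")
    case True
    have "(\<Sum>X\<in>tprod T T'. if dtree w = X then 1 else 0 :: 'k) =
        (if dtree w \<in> tprod T T' then 1 else 0)"
      by (simp add: finite_tprod)
    then show ?thesis
      using True by (simp add: nc_coeff_sum nc_coeff_bP)
  qed (simp add: nc_coeff_sum nc_coeff_bP)
  finally show "nc_coeff (bP T * bP T' :: (nat, 'k) ncseries) w =
      nc_coeff (\<Sum>X\<in>tprod T T'. bP X :: (nat, 'k) ncseries) w" .
qed

lemma bP_Leaf: "bP \<langle>\<rangle> = 1"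
  by (rule ncseries_eqI) (auto simp: nc_coeff_bP one_ncseries.rep_eq)

lemma nc_scale_mult_left: "nc_scale c f * g = nc_scale (c :: 'k::field) (f * g)"
  by transfer (simp add: sum_distrib_left mult.assoc)

lemma nc_scale_mult_right: "f * nc_scale c g = nc_scale (c :: 'k::field) (f * g)"
  by transfer (simp add: sum_distrib_left mult.left_commute)

lemma mult_in_span:
  fixes x y :: "('a, 'k::field) ncseries"
  assumes AB: "\<And>a b. a \<in> A \<Longrightarrow> b \<in> B \<Longrightarrow> a * b \<in> ncseries.span C"
    and x: "x \<in> ncseries.span A" and y: "y \<in> ncseries.span B"
  shows "x * y \<in> ncseries.span C"
proof -
  have *: "a * y \<in> ncseries.span C" if "a \<in> A" for a
    using y
  proof (induction rule: ncseries.span_induct_alt)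
    case (step c b z)
    then show ?case
      using AB that
      by (simp add: distrib_left nc_scale_mult_right ncseries.span_add ncseries.span_scale)
  qed (simp add: ncseries.span_zero)
  show ?thesis
    using x
  proof (induction rule: ncseries.span_induct_alt)
    case (step c a z)
    then show ?case
      using * by (simp add: distrib_right nc_scale_mult_left ncseries.span_add ncseries.span_scale)
  qed (simp add: ncseries.span_zero)
qed

section \<open>Evaluation of noncommutative polynomials\<close>

text \<open>Substitution of \<open>b x\<close> for each letter \<open>x\<close>, the witness for
  \<open>free_on\<close>. A sum over an infinite support is \<open>0\<close> by convention, so the
  algebraic laws are proved for polynomials.\<close>

definition eval_nc :: "('a \<Rightarrow> ('b, 'k::field) ncseries) \<Rightarrow> ('a, 'k) ncseries \<Rightarrow> ('b, 'k) ncseries"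
  where "eval_nc b p = (\<Sum>w | nc_coeff p w \<noteq> 0. nc_scale (nc_coeff p w) (prod_list (map b w)))"

lemma eval_nc_superset:
  assumes "finite A" "{w. nc_coeff p w \<noteq> 0} \<subseteq> A"
  shows "eval_nc b p = (\<Sum>w\<in>A. nc_scale (nc_coeff p w) (prod_list (map b w)))"
  unfolding eval_nc_def using assms by (intro sum.mono_neutral_left) auto

lemma eval_nc_one: "eval_nc b 1 = 1"
  by (subst eval_nc_superset[of "{[]}"]) (auto simp: one_ncseries.rep_eq)

lemma eval_nc_letter: "eval_nc b (nc_letter x) = b x"
  by (subst eval_nc_superset[of "{[x]}"]) (auto simp: nc_letter.rep_eq)

lemma eval_nc_add:
  assumes "p \<in> free_algebra X" "q \<in> free_algebra X"
  shows "eval_nc b (p + q) = eval_nc b p + eval_nc b q"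
proof -
  let ?A = "{w. nc_coeff p w \<noteq> 0} \<union> {w. nc_coeff q w \<noteq> 0}"
  have fin: "finite ?A"
    using assms by (auto simp: free_algebra_def)
  show ?thesis
    by (subst (1 2 3) eval_nc_superset[OF fin])
      (auto simp: plus_ncseries.rep_eq ncseries.scale_left_distrib sum.distrib)
qed

lemma eval_nc_scale:
  assumes "p \<in> free_algebra X"
  shows "eval_nc b (nc_scale c p) = nc_scale c (eval_nc b p)"
proof -
  have fin: "finite {w. nc_coeff p w \<noteq> 0}"
    using assms by (auto simp: free_algebra_def)
  show ?thesis
    by (subst (1 2) eval_nc_superset[OF fin])
      (auto simp: nc_scale.rep_eq ncseries.scale_sum_right)
qed

lemma eval_nc_mult:
  assumes "p \<in> free_algebra X" "q \<in> free_algebra X"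
  shows "eval_nc b (p * q) = eval_nc b p * eval_nc b q"
proof -
  let ?S = "{w. nc_coeff p w \<noteq> 0}" and ?S' = "{w. nc_coeff q w \<noteq> 0}"
  let ?W = "(\<lambda>(u, v). u @ v) ` (?S \<times> ?S')"
  let ?B = "\<lambda>w. prod_list (map b w)"
  let ?t = "\<lambda>(w, i). nc_scale (nc_coeff p (take i w) * nc_coeff q (drop i w)) (?B w)"
  let ?h = "\<lambda>(u, v). (u @ v, length u)"
  have fin: "finite ?S" "finite ?S'"
    using assms by (auto simp: free_algebra_def)
  have W: "w \<in> ?W" if "nc_coeff p (take i w) \<noteq> 0" "nc_coeff q (drop i w) \<noteq> 0" for w i
    using that by (intro image_eqI[of _ _ "(take i w, drop i w)"]) auto
  have "{w. nc_coeff (p * q) w \<noteq> 0} \<subseteq> ?W"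
  proof
    fix w assume "w \<in> {w. nc_coeff (p * q) w \<noteq> 0}"
    then obtain i where "nc_coeff p (take i w) * nc_coeff q (drop i w) \<noteq> 0"
      unfolding times_ncseries.rep_eq by (auto elim!: sum.not_neutral_contains_not_neutral)
    then show "w \<in> ?W"
      using W by (metis mult_zero_left mult_zero_right)
  qed
  then have "eval_nc b (p * q) = (\<Sum>w\<in>?W. nc_scale (nc_coeff (p * q) w) (?B w))"
    using fin by (intro eval_nc_superset) auto
  also have "\<dots> = (\<Sum>w\<in>?W. \<Sum>i\<le>length w. ?t (w, i))"
    by (simp add: times_ncseries.rep_eq ncseries.scale_sum_left)
  also have "\<dots> = sum ?t (Sigma ?W (\<lambda>w. {..length w}))"
    using fin by (subst sum.Sigma) auto
  \<comment> \<open>A word with a cut is the same as a pair of words; only pairs from the two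
    supports contribute.\<close>
  also have "\<dots> = sum ?t (?h ` (?S \<times> ?S'))"
  proof (rule sum.mono_neutral_right)
    show "\<forall>z\<in>Sigma ?W (\<lambda>w. {..length w}) - ?h ` (?S \<times> ?S'). ?t z = 0"
    proof
      fix z assume z: "z \<in> Sigma ?W (\<lambda>w. {..length w}) - ?h ` (?S \<times> ?S')"
      obtain w i where wi: "z = (w, i)"
        by (cases z)
      have "z = ?h (take i w, drop i w)"
        using z wi by auto
      then have "(take i w, drop i w) \<notin> ?S \<times> ?S'"
        using z by blast
      then show "?t z = 0"
        using wi by auto
    qed
  qed (use fin in auto)
  also have "\<dots> = (\<Sum>(u, v)\<in>?S \<times> ?S'. nc_scale (nc_coeff p u * nc_coeff q v) (?B u * ?B v))"
    by (subst sum.reindex) (auto simp: inj_on_def intro!: sum.cong)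
  also have "\<dots> = eval_nc b p * eval_nc b q"
    by (simp add: eval_nc_def sum_product sum.cartesian_product nc_scale_mult_left
        nc_scale_mult_right mult.commute)
  finally show ?thesis .
qed

lemma free_algebra_add:
  assumes "p \<in> free_algebra X" "q \<in> free_algebra X"
  shows "p + q \<in> free_algebra X"
proof -
  have "{w. nc_coeff (p + q) w \<noteq> 0} \<subseteq> {w. nc_coeff p w \<noteq> 0} \<union> {w. nc_coeff q w \<noteq> 0}"
    by (auto simp: plus_ncseries.rep_eq)
  then show ?thesis
    using assms finite_subset[OF _ finite_UnI] unfolding free_algebra_def by blast
qed

lemma free_algebra_scale: "p \<in> free_algebra X \<Longrightarrow> nc_scale c p \<in> free_algebra X"
  for c :: "'k::field"
  unfolding free_algebra_def by (auto simp: nc_scale.rep_eq)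

lemma eval_nc_word:
  assumes "w \<in> lists X"
  shows "\<exists>p\<in>free_algebra X. eval_nc b p = prod_list (map b w)"
proof
  let ?p = "Abs_ncseries (\<lambda>v. if v = w then 1 else 0)"
  have c: "nc_coeff ?p v = (if v = w then 1 else 0)" for v
    by (simp add: Abs_ncseries_inverse)
  show "?p \<in> free_algebra X"
    using assms by (auto simp: free_algebra_def c)
  show "eval_nc b ?p = prod_list (map b w)"
    by (subst eval_nc_superset[of "{w}"]) (auto simp: c)
qed

lemma free_onI:
  fixes S :: "('b, 'k::field) ncseries set"
  assumes inj: "\<And>p. p \<in> free_algebra X \<Longrightarrow> eval_nc b p = 0 \<Longrightarrow> p = 0"
    and S: "S = ncseries.span ((\<lambda>w. prod_list (map b w)) ` lists X)"
  shows "free_on S X b"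
  unfolding free_on_def
proof (intro exI conjI ballI allI)
  show "bij_betw (eval_nc b) (free_algebra X) S"
    unfolding bij_betw_def
  proof
    show "inj_on (eval_nc b) (free_algebra X)"
    proof
      fix p q :: "('a, 'k) ncseries"
      assume pq: "p \<in> free_algebra X" "q \<in> free_algebra X" "eval_nc b p = eval_nc b q"
      \<comment> \<open>The difference, written with the two operations for which
        \<open>eval_nc\<close> is known to be linear.\<close>
      let ?d = "p + nc_scale (-1) q"
      have "eval_nc b ?d = eval_nc b p + eval_nc b (nc_scale (-1) q)"
        by (rule eval_nc_add[OF pq(1) free_algebra_scale[OF pq(2)]])
      also have "\<dots> = 0"
        unfolding eval_nc_scale[OF pq(2)] pq(3) by simp
      finally have "?d = 0"
        by (rule inj[OF free_algebra_add[OF pq(1) free_algebra_scale[OF pq(2)]]])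
      then show "p = q"
        by simp
    qed
    show "eval_nc b ` free_algebra X = S"
    proof
      show "eval_nc b ` free_algebra X \<subseteq> S"
        unfolding S eval_nc_def
        by (intro image_subsetI ncseries.span_sum ncseries.span_scale ncseries.span_base)
          (auto simp: free_algebra_def)
      show "S \<subseteq> eval_nc b ` free_algebra X"
      proof
        fix x assume "x \<in> S"
        then show "x \<in> eval_nc b ` free_algebra X"
          unfolding S
        proof (induction rule: ncseries.span_induct_alt)
          case base
          show ?case
            by (rule image_eqI[of _ _ 0])
              (auto simp: eval_nc_def free_algebra_def zero_ncseries.rep_eq)
        next
          case (step c y z)
          then obtain w q where "w \<in> lists X" "y = prod_list (map b w)"
            "q \<in> free_algebra X" "z = eval_nc b q"
            by blast
          moreover from this obtain p where "p \<in> free_algebra X" "eval_nc b p = y"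
            using eval_nc_word by metis
          ultimately show ?case
            by (intro image_eqI[of _ _ "nc_scale c p + q"])
              (simp_all add: eval_nc_add[OF free_algebra_scale] eval_nc_scale
                free_algebra_add free_algebra_scale)
        qed
      qed
    qed
  qed
qed (simp_all add: eval_nc_one eval_nc_letter eval_nc_add eval_nc_scale eval_nc_mult)

section \<open>Triangularity along the right spine\<close>

abbreviation indecomposables :: "btree set" where
  "indecomposables \<equiv> {T. T \<noteq> \<langle>\<rangle> \<and> right T = \<langle>\<rangle>}"

fun spine :: "btree \<Rightarrow> btree list" where
  "spine \<langle>\<rangle> = []"
| "spine \<langle>L, x, R\<rangle> = \<langle>L, (), \<langle>\<rangle>\<rangle> # spine R"

text \<open>Discards the right subtrees of the letters, so it is inverse to \<open>spine\<close>
  only on \<open>lists indecomposables\<close>.\<close>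

fun graft :: "btree list \<Rightarrow> btree" where
  "graft [] = \<langle>\<rangle>"
| "graft (T # w) = \<langle>left T, (), graft w\<rangle>"

lemma graft_spine: "graft (spine T) = T"
  by (induction T rule: spine.induct) auto

lemma spine_in_lists: "spine T \<in> lists indecomposables"
  by (induction T rule: spine.induct) auto

lemma indecomposableE:
  assumes "T \<in> indecomposables"
  obtains L where "T = \<langle>L, (), \<langle>\<rangle>\<rangle>"
  using assms by (cases T) auto

lemma spine_graft: "w \<in> lists indecomposables \<Longrightarrow> spine (graft w) = w"
proof (induction w)
  case (Cons T w)
  then have "T \<in> indecomposables" "w \<in> lists indecomposables"
    by auto
  then show ?case
    using Cons.IH by (cases T) auto
qed simp

text \<open>Ordered lexicographically, by the instance of \<open>HOL-Library.Product_Lexorder\<close>.\<close>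

definition rank :: "(btree \<Rightarrow> nat) \<Rightarrow> btree \<Rightarrow> nat \<times> nat" where
  "rank m T = (length (spine T), sum_list (map m (spine T)))"

lemma rank_Node:
  "rank m \<langle>L, x, R\<rangle> = (Suc (fst (rank m R)), m \<langle>L, (), \<langle>\<rangle>\<rangle> + snd (rank m R))"
  by (simp add: rank_def)

text \<open>In the first branch of \<open>tprod\<close> all of \<open>R\<close> becomes the right
  subtree, which gives the leading term. In the second the left factor is absorbed into the left
  subtree of \<open>R\<close>, so the spine is no longer than that of \<open>R\<close>.\<close>

lemma bP_mult_indecomposable:
  "bP \<langle>L, (), \<langle>\<rangle>\<rangle> * bP R - bP \<langle>L, (), R\<rangle>
     \<in> ncseries.span (bP ` {Y. length (spine Y) < Suc (length (spine R))})"
proof (cases R)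
  case Leaf
  then show ?thesis
    by (simp add: bP_Leaf ncseries.span_zero)
next
  case (Node L' y R')
  let ?A = "(\<lambda>X. \<langle>X, (), R'\<rangle>) ` tprod \<langle>L, (), \<langle>\<rangle>\<rangle> L'"
  have "tprod \<langle>L, (), \<langle>\<rangle>\<rangle> R = insert \<langle>L, (), R\<rangle> ?A"
    by (simp add: Node)
  moreover have "\<langle>L, (), R\<rangle> \<notin> ?A"
    by (auto simp: Node dest: arg_cong[of _ _ size])
  ultimately have "bP \<langle>L, (), \<langle>\<rangle>\<rangle> * bP R - bP \<langle>L, (), R\<rangle> = sum bP ?A"
    by (simp add: bP_mult finite_tprod)
  also have "\<dots> \<in> ncseries.span (bP ` {Y. length (spine Y) < Suc (length (spine R))})"
    by (intro ncseries.span_sum ncseries.span_base) (auto simp: Node)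
  finally show ?thesis .
qed

text \<open>Distinct \<open>bP\<close> have disjoint supports.\<close>

lemma nc_coeff_span_bP:
  assumes "f \<in> ncseries.span (bP ` A)" and "dtree x \<notin> A"
  shows "nc_coeff f x = 0"
  using assms(1)
  by (induction rule: ncseries.span_induct_alt)
    (use assms(2) in \<open>auto simp: zero_ncseries.rep_eq plus_ncseries.rep_eq nc_scale.rep_eq nc_coeff_bP
      split: if_splits\<close>)

text \<open>Treats both families at once: \<open>m\<close> is constant for \<open>bP\<close> and
  counts the inversions of the canonical word for \<open>bH\<close>.\<close>

context
  fixes b :: "btree \<Rightarrow> (nat, 'k::field_char_0) ncseries" and m :: "btree \<Rightarrow> nat"
  assumes triangular: "\<And>T. T \<in> indecomposables \<Longrightarrow>
    b T - bP T \<in> ncseries.span (bP ` {Y \<in> indecomposables. m Y < m T})"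
begin

lemma prod_list_triangular:
  assumes "w \<in> lists indecomposables"
  shows "prod_list (map b w) - bP (graft w)
           \<in> ncseries.span (bP ` {Y. rank m Y < rank m (graft w)})"
  using assms
proof (induction w)
  case Nil
  then show ?case
    by (simp add: bP_Leaf ncseries.span_zero)
next
  case (Cons T w)
  let ?R = "graft w" and ?p = "prod_list (map b w)"
  let ?V = "ncseries.span (bP ` {Y. rank m Y < rank m (graft (T # w))}) :: (nat, 'k) ncseries set"
  obtain L where T: "T = \<langle>L, (), \<langle>\<rangle>\<rangle>"
    using Cons.hyps(1) by (rule indecomposableE)
  \<comment> \<open>The rank compares spine lengths first, and \<open>graft (T # w)\<close> has one
    spine node more than \<open>?R\<close>.\<close>
  have short: "f \<in> ?V"
    if "f \<in> ncseries.span (bP ` {Y. length (spine Y) < Suc (length (spine Z))})"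
      "rank m Z \<le> rank m ?R" for f Z
  proof -
    have "bP ` {Y. length (spine Y) < Suc (length (spine Z))}
        \<subseteq> bP ` {Y. rank m Y < rank m (graft (T # w))}"
      using that(2) by (intro image_mono) (auto simp: rank_def T)
    then show ?thesis
      using that(1) ncseries.span_mono by blast
  qed
  \<comment> \<open>When one factor drops and the other does not grow, the leading tree of the
    product has smaller rank; its other trees are covered by \<open>short\<close>.\<close>
  have low: "bP Y * bP Z \<in> ?V"
    if Y: "Y \<in> indecomposables"
      and YZ: "m Y < m T \<and> rank m Z \<le> rank m ?R \<or> m Y \<le> m T \<and> rank m Z < rank m ?R" for Y Z
  proof -
    obtain M where M: "Y = \<langle>M, (), \<langle>\<rangle>\<rangle>"
      using Y by (rule indecomposableE)
    have "rank m \<langle>M, (), Z\<rangle> < rank m (graft (T # w))"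
      using YZ by (cases "rank m Z"; cases "rank m ?R") (auto simp: rank_Node T M)
    then have "bP \<langle>M, (), Z\<rangle> \<in> ?V"
      by (intro ncseries.span_base) auto
    moreover have "bP Y * bP Z - bP \<langle>M, (), Z\<rangle> \<in> ?V"
      unfolding M using YZ by (intro short[OF bP_mult_indecomposable]) auto
    ultimately show ?thesis
      by (metis ncseries.span_add diff_add_cancel)
  qed
  let ?d = "b T - bP T" and ?l = "?p - bP ?R"
  \<comment> \<open>Each factor is split into leading term and error. Only the product of the two
    leading terms reaches the rank of \<open>graft (T # w)\<close>.\<close>
  have "b T * ?p - bP (graft (T # w)) =
      (bP T * bP ?R - bP \<langle>L, (), ?R\<rangle>) + (?d * bP ?R + (bP T * ?l + ?d * ?l))"
    by (simp add: algebra_simps T)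
  moreover have "bP T * bP ?R - bP \<langle>L, (), ?R\<rangle> \<in> ?V"
    using short[OF bP_mult_indecomposable[of L ?R] order_refl] unfolding T .
  moreover have d: "?d \<in> ncseries.span (bP ` {Y \<in> indecomposables. m Y < m T})"
    using triangular Cons.hyps by blast
  moreover have l: "?l \<in> ncseries.span (bP ` {Y. rank m Y < rank m ?R})"
    by (rule Cons.IH)
  moreover have "?d * bP ?R \<in> ?V"
    by (rule mult_in_span[OF _ d ncseries.span_base[OF singletonI]])
      (auto intro!: low simp del: graft.simps)
  moreover have "bP T * ?l \<in> ?V"
    using Cons.hyps
    by (intro mult_in_span[OF _ ncseries.span_base[OF singletonI] l])
      (auto intro!: low simp del: graft.simps)
  moreover have "?d * ?l \<in> ?V"
    by (rule mult_in_span[OF _ d l])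
      (auto intro!: low simp del: graft.simps)
  ultimately show ?case
    by (simp add: ncseries.span_add)
qed

lemma PBT_eq_span_prod_list:
  "PBT = ncseries.span ((\<lambda>w. prod_list (map b w)) ` lists indecomposables)" (is "_ = ?S")
proof
  have "bP T \<in> ?S" for T
  \<comment> \<open>Infinitely many trees may lie below a given rank, but the lexicographic order on
    pairs of naturals is well-founded, so the triangular relation can be inverted.\<close>
  proof (induction "rank m T" arbitrary: T rule: less_induct)
    case less
    let ?B = "prod_list (map b (spine T))"
    have "?B \<in> ?S"
      using spine_in_lists by (intro ncseries.span_base) blast
    moreover have "?B - bP T \<in> ?S"
    proof -
      have "?B - bP T \<in> ncseries.span (bP ` {Y. rank m Y < rank m T})"
        using prod_list_triangular[OF spine_in_lists] by (simp add: graft_spine)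
      moreover have "bP ` {Y. rank m Y < rank m T} \<subseteq> ?S"
        using less by blast
      ultimately show ?thesis
        using ncseries.span_minimal[OF _ ncseries.subspace_span] by blast
    qed
    ultimately have "?B - (?B - bP T) \<in> ?S"
      by (rule ncseries.span_diff)
    then show ?case
      by simp
  qed
  then show "PBT \<subseteq> ?S"
    unfolding PBT_def by (intro ncseries.span_minimal) auto
  have "prod_list (map b w) \<in> PBT" if "w \<in> lists indecomposables" for w
  proof -
    have "prod_list (map b w) - bP (graft w) \<in> PBT"
      using prod_list_triangular[OF that] ncseries.span_mono[OF image_mono[OF subset_UNIV]]
      unfolding PBT_def by blast
    moreover have "bP (graft w) \<in> PBT"
      unfolding PBT_def by (intro ncseries.span_base) auto
    ultimately show ?thesis
      unfolding PBT_def by (metis ncseries.span_add diff_add_cancel)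
  qed
  then show "?S \<subseteq> PBT"
    unfolding PBT_def by (intro ncseries.span_minimal) auto
qed

text \<open>Take a word \<open>w\<close> of maximal rank in the support of \<open>p\<close> and
  evaluate at a word \<open>x\<close> whose decreasing tree is \<open>graft w\<close>: only the
  summand of \<open>w\<close> survives.\<close>

lemma eval_nc_eq_0_imp:
  assumes p: "p \<in> free_algebra indecomposables" and 0: "eval_nc b p = 0"
  shows "p = 0"
proof (rule ccontr)
  let ?S = "{w. nc_coeff p w \<noteq> 0}"
  assume "p \<noteq> 0"
  then have "?S \<noteq> {}"
    by (auto simp: zero_ncseries.rep_eq intro: ncseries_eqI)
  have S: "finite ?S" "?S \<subseteq> lists indecomposables"
    using p by (auto simp: free_algebra_def)
  let ?M = "Max ((\<lambda>w. rank m (graft w)) ` ?S)"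
  have "?M \<in> (\<lambda>w. rank m (graft w)) ` ?S"
    using S(1) \<open>?S \<noteq> {}\<close> by (intro Max_in) auto
  then obtain w where w: "w \<in> ?S" "?M = rank m (graft w)"
    by blast
  have max: "rank m (graft v) \<le> rank m (graft w)" if "v \<in> ?S" for v
    unfolding w(2)[symmetric] using S(1) that by (intro Max_ge) auto
  obtain x where x: "x \<in> lists {1..}" "dtree x = graft w"
    using ex_word_dtree by blast
  \<comment> \<open>The error terms of \<open>v\<close> have rank below that of
    \<open>graft w\<close> and vanish at \<open>x\<close>. Words of equal rank are told apart
    because \<open>graft\<close> is injective on these lists.\<close>
  have coeff: "nc_coeff (prod_list (map b v)) x = (if v = w then 1 else 0)" if v: "v \<in> ?S" for v
  proof -
    have vl: "v \<in> lists indecomposables" and wl: "w \<in> lists indecomposables"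
      using S(2) v w(1) by blast+
    have "nc_coeff (prod_list (map b v) - bP (graft v)) x = 0"
      using max[OF v] by (intro nc_coeff_span_bP[OF prod_list_triangular[OF vl]])
        (simp only: x(2) mem_Collect_eq not_less)
    then have "nc_coeff (prod_list (map b v)) x = (if graft w = graft v then 1 else 0)"
      using x by (simp add: minus_ncseries.rep_eq nc_coeff_bP split: if_splits)
    moreover have "graft w = graft v \<longleftrightarrow> v = w"
      using spine_graft[OF vl] spine_graft[OF wl] by metis
    ultimately show ?thesis
      by simp
  qed
  have "0 = nc_coeff (eval_nc b p) x"
    by (simp add: 0 zero_ncseries.rep_eq)
  also have "\<dots> = (\<Sum>v\<in>?S. nc_coeff p v * nc_coeff (prod_list (map b v)) x)"
    by (simp add: eval_nc_def nc_coeff_sum nc_scale.rep_eq)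
  also have "\<dots> = (\<Sum>v\<in>?S. if v = w then nc_coeff p v else 0)"
    using coeff by (intro sum.cong) auto
  also have "\<dots> = nc_coeff p w"
    using w(1) S(1) by simp
  finally show False
    using w(1) by simp
qed

theorem free_on_PBT_triangular: "free_on PBT indecomposables b"
  by (rule free_onI[OF eval_nc_eq_0_imp PBT_eq_span_prod_list])

end

section \<open>Canonical words and the weak order\<close>

text \<open>An explicit form of the canonical labelling; the offset \<open>a\<close> is needed to
  recurse into the right subtree.\<close>

fun label :: "nat \<Rightarrow> btree \<Rightarrow> nat tree" where
  "label a \<langle>\<rangle> = \<langle>\<rangle>"
| "label a \<langle>L, x, R\<rangle> = \<langle>label a L, Suc (a + size L), label (Suc (a + size L)) R\<rangle>"

lemma shape_label: "shape (label a T) = T"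
  by (induction a T rule: label.induct) (auto simp: shape_def)

lemma inorder_label: "inorder (label a T) = [Suc a..<Suc (a + size T)]"
proof (induction a T rule: label.induct)
  case (2 a L x R)
  then show ?case
    using upt_add_eq_append[of "Suc a" "Suc (a + size L)" "Suc (size R)"]
    by (simp add: upt_conv_Cons add.assoc del: upt_Suc)
qed simp

lemma tree_eq_if_shape_inorder_eq:
  "shape t = shape t' \<Longrightarrow> inorder t = inorder t' \<Longrightarrow> t = t'"
proof (induction t arbitrary: t')
  case Leaf
  then show ?case
    by (cases t') (auto simp: shape_def)
next
  case (Node l x r)
  then obtain l' x' r' where t': "t' = \<langle>l', x', r'\<rangle>"
    and sh: "shape l = shape l'" "shape r = shape r'"
    by (cases t') (auto simp: shape_def)
  have "length (inorder l) = length (inorder l')"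
    using arg_cong[OF sh(1), of size] by (simp add: shape_def)
  then show ?case
    using Node sh by (auto simp: t')
qed

lemma canonical_labelling_eq: "canonical_labelling T = label 0 T"
  unfolding canonical_labelling_def
proof (rule the_equality)
  show "shape (label 0 T) = T \<and> bst (label 0 T) \<and> set_tree (label 0 T) = {1..size T}"
    by (auto simp: shape_label bst_iff_sorted_wrt_less inorder_label simp flip: set_inorder
        simp del: upt_Suc)
next
  fix t assume t: "shape t = T \<and> bst t \<and> set_tree t = {1..size T}"
  have "sorted_wrt (<) (inorder t)" "sorted_wrt (<) (inorder (label 0 T))"
    using t by (simp_all add: bst_iff_sorted_wrt_less inorder_label del: upt_Suc)
  moreover have "set (inorder t) = set (inorder (label 0 T))"
    using t by (simp add: inorder_label atLeastLessThanSuc_atLeastAtMost del: upt_Suc)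
  ultimately have "inorder t = inorder (label 0 T)"
    by (metis strict_sorted_equal)
  moreover have "shape t = shape (label 0 T)"
    using t by (simp add: shape_label)
  ultimately show "t = label 0 T"
    by (metis tree_eq_if_shape_inorder_eq)
qed

lemma label_add: "label (a + k) T = map_tree ((+) a) (label k T)"
  by (induction k T rule: label.induct) (simp_all add: add.assoc flip: add_Suc_right)

lemma rl_postfix_map_tree: "rl_postfix (map_tree f t) = map f (rl_postfix t)"
  by (induction t) auto

lemma canonical_word_Leaf [simp]: "canonical_word \<langle>\<rangle> = []"
  by (simp add: canonical_word_def canonical_labelling_eq)

lemma canonical_word_Node [simp]:
  "canonical_word \<langle>L, x, R\<rangle> =
     map ((+) (Suc (size L))) (canonical_word R) @ canonical_word L @ [Suc (size L)]"
  using label_add[of "Suc (size L)" 0 R]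
  by (simp add: canonical_word_def canonical_labelling_eq rl_postfix_map_tree)

lemma length_canonical_word [simp]: "length (canonical_word T) = size T"
  by (induction T) auto

lemma set_canonical_word: "set (canonical_word T) = {1..size T}"
proof (induction T)
  case (Node L x R)
  have "(+) (Suc (size L)) ` {1..size R} = {Suc (Suc (size L))..Suc (size L + size R)}"
    using image_add_atLeastAtMost[of "Suc (size L)" 1 "size R"] by simp
  then show ?case
    by (auto simp: Node)
qed simp

lemma canonical_word_in_perms: "canonical_word T \<in> perms (size T)"
  by (rule permutations_of_setI)
    (auto simp: set_canonical_word card_distinct)

text \<open>The last letter reveals the size of the left subtree, hence where to cut the word into
  the parts of the two subtrees.\<close>

lemma inj_canonical_word: "inj canonical_word"
proof
  show "canonical_word T = canonical_word T' \<Longrightarrow> T = T'" for T T'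
  proof (induction T arbitrary: T')
    case Leaf
    then show ?case
      using length_canonical_word[of T'] by simp
  next
    case (Node L x R)
    then obtain L' y R' where T': "T' = \<langle>L', y, R'\<rangle>"
      by (cases T') auto
    show ?case
      using Node by (auto simp: T' inj_map_eq_map)
  qed
qed

text \<open>A nonempty right subtree contributes a shifted final factor to the mirror image. Without
  one, the mirror image starts with its maximum, so a prefix that is a permutation is already the
  whole word.\<close>

lemma anticonnected_canonical_word_iff:
  assumes "T \<noteq> \<langle>\<rangle>"
  shows "anticonnected_perm (canonical_word T) \<longleftrightarrow> right T = \<langle>\<rangle>"
proof -
  obtain L x R where T: "T = \<langle>L, x, R\<rangle>"
    using assms by (cases T) auto
  show ?thesis
  proof (cases "R = \<langle>\<rangle>")
    case True
    have "u = [] \<or> v = []"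
      if "u \<in> perms k" "rev (canonical_word T) = shifted_concat u v" for k u v
    proof (cases u)
      case (Cons a u')
      then have a: "a = Suc (size L)"
        using that(2) by (simp add: T True shifted_concat_def)
      have "set u = {1..k}" "length u = k"
        using that(1) by (auto simp: permutations_of_set_def dest: distinct_card)
      moreover have "a \<in> set u"
        by (simp add: Cons)
      ultimately have "Suc (size L) \<le> length u"
        unfolding a by simp
      moreover have "length u + length v = Suc (size L)"
        using arg_cong[OF that(2), of length] by (simp add: T True shifted_concat_def)
      ultimately have "length v = 0"
        by linarith
      then show ?thesis
        by simp
    qed simp
    then have "connected_perm (rev (canonical_word T))"
      unfolding connected_perm_def by blast
    then show ?thesis
      by (simp add: anticonnected_perm_def T True)
  next
    case False
    let ?u = "Suc (size L) # rev (canonical_word L)" and ?v = "rev (canonical_word R)"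
    have "?u \<in> perms (Suc (size L))" "?v \<in> perms (size R)"
      using canonical_word_in_perms[of L] canonical_word_in_perms[of R]
      by (auto simp: permutations_of_set_def atLeastAtMostSuc_conv)
    moreover have "?v \<noteq> []"
      using False by (cases R) auto
    moreover have "rev (canonical_word T) = shifted_concat ?u ?v"
      by (simp add: T shifted_concat_def rev_map add.commute)
    ultimately have "\<not> connected_perm (rev (canonical_word T))"
      unfolding connected_perm_def by blast
    then show ?thesis
      by (simp add: anticonnected_perm_def T False)
  qed
qed

section \<open>Inversions and the weak order\<close>

lemma inversions_swap_le:
  assumes "Suc i < length \<sigma>" and "\<sigma> ! Suc i \<le> \<sigma> ! i"
  shows "inversions (\<sigma>[i := \<sigma> ! Suc i, Suc i := \<sigma> ! i]) \<le> inversions \<sigma>"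
proof -
  let ?\<tau> = "\<sigma>[i := \<sigma> ! Suc i, Suc i := \<sigma> ! i]"
  let ?I = "\<lambda>\<sigma>. {(p, q). p < q \<and> q < length \<sigma> \<and> \<sigma> ! p > (\<sigma> ! q :: nat)}"
  let ?t = "transpose i (Suc i)"
  have fin: "finite (?I \<sigma>)"
    by (rule finite_subset[of _ "{..<length \<sigma>} \<times> {..<length \<sigma>}"]) auto
  have t: "?\<tau> ! p = \<sigma> ! ?t p" "?t p < length \<sigma>" if "p < length \<sigma>" for p
    using that assms(1) by (auto simp: transpose_def nth_list_update)
  have "(\<lambda>(p, q). (?t p, ?t q)) ` ?I ?\<tau> \<subseteq> ?I \<sigma>"
  proof clarify
    fix p q assume pq: "p < q" "q < length ?\<tau>" "?\<tau> ! q < ?\<tau> ! p"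
    \<comment> \<open>The only pair whose order the transposition reverses; after the swap of a weak
      descent it is not an inversion.\<close>
    have "(p, q) \<noteq> (i, Suc i)"
      using pq assms by auto
    then have "?t p < ?t q"
      using pq(1) by (auto simp: transpose_def)
    then show "?t p < ?t q \<and> ?t q < length \<sigma> \<and> \<sigma> ! ?t q < \<sigma> ! ?t p"
      using pq t[of p] t[of q] by auto
  qed
  moreover have "inj_on (\<lambda>(p, q). (?t p, ?t q)) (?I ?\<tau>)"
    by (auto simp: inj_on_def dest: injD[OF inj_transpose])
  ultimately show ?thesis
    unfolding inversions_def using fin by (metis (no_types, lifting) card_inj_on_le)
qed

lemma weak_step_props:
  assumes "weak_step \<sigma> \<tau>"
  shows "length \<sigma> = length \<tau>" "set \<sigma> = set \<tau>" "inversions \<sigma> < inversions \<tau>"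
    "(\<And>x. x \<in> set \<tau> \<Longrightarrow> x \<le> last \<tau>) \<Longrightarrow> last \<sigma> = last \<tau>"
proof -
  obtain i where i: "Suc i < length \<sigma>" "\<tau> = \<sigma>[i := \<sigma> ! Suc i, Suc i := \<sigma> ! i]"
    and inv: "inversions \<sigma> < inversions \<tau>"
    using assms by (auto simp: weak_step_def)
  show len: "length \<sigma> = length \<tau>"
    by (simp add: i)
  show "inversions \<sigma> < inversions \<tau>"
    by (rule inv)
  show "set \<sigma> = set \<tau>"
    using i set_swap[of i \<sigma> "Suc i"] by simp
  have up: "\<sigma> ! i < \<sigma> ! Suc i"
    using inversions_swap_le[OF i(1)] inv unfolding i(2) by linarith
  assume max: "\<And>x. x \<in> set \<tau> \<Longrightarrow> x \<le> last \<tau>"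
  have "\<tau> ! i \<le> last \<tau>"
    using i(1) len by (intro max nth_mem) simp
  moreover have "last \<tau> = \<tau> ! (length \<sigma> - 1)" "last \<sigma> = \<sigma> ! (length \<sigma> - 1)"
    using i(1) len by (metis last_conv_nth list.size(3) not_less_zero)+
  ultimately show "last \<sigma> = last \<tau>"
    \<comment> \<open>A step exchanges an ascent. If it touched the last position, the letter before
      the last in \<open>\<tau>\<close> would exceed \<open>last \<tau>\<close>.\<close>
    using i up by (auto simp: nth_list_update split: if_splits)
qed

lemma weak_le_props:
  assumes "weak_le \<sigma> \<tau>"
  shows "length \<sigma> = length \<tau> \<and> set \<sigma> = set \<tau> \<and> (\<sigma> = \<tau> \<or> inversions \<sigma> < inversions \<tau>) \<and>
    ((\<forall>x\<in>set \<tau>. x \<le> last \<tau>) \<longrightarrow> last \<sigma> = last \<tau>)"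
  using assms unfolding weak_le_def
proof (induction rule: converse_rtranclp_induct)
  case (step \<rho> \<sigma>)
  then show ?case
    using weak_step_props[OF step(1)] by auto
qed simp

text \<open>The canonical word of \<open>T\<close> ends with its maximum, and so do all words below
  it, which have fewer inversions unless equal.\<close>

lemma bH_triangular:
  assumes T: "T \<in> indecomposables"
  shows "bH T - bP T
    \<in> ncseries.span (bP ` {Y \<in> indecomposables.
        inversions (canonical_word Y) < inversions (canonical_word T)})"
proof -
  let ?D = "{Y. weak_le (canonical_word Y) (canonical_word T)}"
  obtain L where L: "T = \<langle>L, (), \<langle>\<rangle>\<rangle>"
    using T by (rule indecomposableE)
  have "canonical_word ` ?D \<subseteq> {w. set w \<subseteq> {1..size T} \<and> length w = size T}"
  proof clarify
    fix Y assume "weak_le (canonical_word Y) (canonical_word T)"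
    from weak_le_props[OF this]
    show "set (canonical_word Y) \<subseteq> {1..size T} \<and> length (canonical_word Y) = size T"
      using set_canonical_word[of T] by simp
  qed
  then have "finite (canonical_word ` ?D)"
    by (rule finite_subset) (simp add: finite_lists_length_eq)
  \<comment> \<open>Needed to split off the summand of \<open>T\<close>, as an infinite sum is
    \<open>0\<close> by convention.\<close>
  then have fin: "finite ?D"
    by (rule finite_imageD) (rule inj_on_subset[OF inj_canonical_word subset_UNIV])
  have "T \<in> ?D"
    by (simp add: weak_le_def)
  then have "bH T - bP T = sum bP (?D - {T})"
    using fin by (simp add: bH_def sum_diff1)
  also have "\<dots> \<in> ncseries.span (bP ` {Y \<in> indecomposables.
        inversions (canonical_word Y) < inversions (canonical_word T)})"
  proof (intro ncseries.span_sum ncseries.span_base imageI)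
    fix Y assume Y: "Y \<in> ?D - {T}"
    then have le: "weak_le (canonical_word Y) (canonical_word T)"
      and ne: "canonical_word Y \<noteq> canonical_word T"
      using inj_canonical_word by (auto dest: injD)
    have "\<forall>x\<in>set (canonical_word T). x \<le> last (canonical_word T)"
      unfolding set_canonical_word by (simp add: L)
    then have props: "size Y = Suc (size L)" "last (canonical_word Y) = Suc (size L)"
        "inversions (canonical_word Y) < inversions (canonical_word T)"
      using weak_le_props[OF le] ne by (auto simp: L)
    then obtain A x B where "Y = \<langle>A, x, B\<rangle>"
      by (cases Y) auto
    \<comment> \<open>The last letter of the canonical word of \<open>Y\<close> is
      \<open>Suc (size A)\<close>. It equals \<open>size Y\<close>, so \<open>B\<close> is
      empty.\<close>
    with props show "Y \<in> {Y \<in> indecomposables.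
        inversions (canonical_word Y) < inversions (canonical_word T)}"
      by simp
  qed
  finally show ?thesis .
qed

theorem mainTheorem13:
  shows "free_on (PBT :: (nat, 'k::field_char_0) ncseries set)
           {T. T \<noteq> \<langle>\<rangle> \<and> right T = \<langle>\<rangle>} bP \<and>
         free_on (PBT :: (nat, 'k) ncseries set)
           {T. T \<noteq> \<langle>\<rangle> \<and> right T = \<langle>\<rangle>} bH \<and>
         {T. T \<noteq> \<langle>\<rangle> \<and> right T = \<langle>\<rangle>} =
           {T. T \<noteq> \<langle>\<rangle> \<and> anticonnected_perm (canonical_word T)}"
proof (intro conjI)
  show "free_on (PBT :: (nat, 'k) ncseries set) indecomposables bP"
    \<comment> \<open>The error term \<open>bP T - bP T\<close> is \<open>0\<close>, so a constant
      measure suffices.\<close>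
    by (rule free_on_PBT_triangular[where m = "\<lambda>_. 0"]) (simp add: ncseries.span_zero)
  show "free_on (PBT :: (nat, 'k) ncseries set) indecomposables bH"
    by (rule free_on_PBT_triangular[OF bH_triangular])
qed (use anticonnected_canonical_word_iff in blast)

end
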